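(* Let $F(n)=\sum_{\pi\in S_n}q^{(c-ba)(\pi)}$ for $n\ge0$ (so $F(0)=1$). For $n,k\ge1$ let $$a(n,k)=\sum_{n\ge t_1>\cdots>t_k\ge1}\ \prod_{j=1}^{k-1}(q^{n-t_j}-1),\quad b(n,k)=\sum_{n\ge t_1>\cdots>t_k\ge1}t_k\prod_{j=1}^{k}(q^{n-t_j}-1),\quad c(n,k)=\sum_{n\ge t_1>\cdots>t_k\ge1}\ \prod_{j=1}^{k}(q^{n-t_j}-1).$$ Then for all $n\ge1$, $$F(n)=\sum_{k=1}^n a(n,k)F(n-k),$$ and for all $n,k\ge2$, $$a(n,k)=b(n-1,k-1),$$ $$b(n,k)=b(n-1,k)+c(n-1,k)+(q^{n-1}-1)\,c(n-1,k-1),$$ $$c(n,k)=c(n-1,k)+(q^{n-1}-1)\,c(n-1,k-1).$$ The same recurrence for $F$ (with the same $a(n,k)$) holds when $(c-ba)$ is replaced by its reversal, its complement, or its reverse-complement.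
   Context: $S_n$ is the set of permutations $\pi=\pi_1\cdots\pi_n$ of $\{1,\dots,n\}$ in one-line notation. $(c-ba)(\pi)$ is the number of pairs $(i,j)$ with $1\le i<j<n$ and $\pi_{j+1}<\pi_j<\pi_i$. The sums are over integer tuples $(t_1,\dots,t_k)$; empty sums are $0$ and empty products are $1$. For a statistic $\sigma$, the reversal, complement and reverse-complement are $\sigma^r(\pi)=\sigma(\pi^r)$, $\sigma^c(\pi)=\sigma(\pi^c)$ and $\sigma^{cr}(\pi)=\sigma((\pi^c)^r)$, where $\pi^r=\pi_n\cdots\pi_1$ and $\pi^c=(n+1-\pi_1)\cdots(n+1-\pi_n)$. *)

theory Defs
  imports "HOL-Combinatorics.Multiset_Permutations"
begin

(* A permutation of {1,...,n} in one-line notation is a list in permutations_of_set {1..n}.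
   Lists are indexed from 0, so the pair (i, j) below stands for (i+1, j+1) in
   1-based indexing, and 1 <= i < j < n becomes i < j together with Suc j < length p. *)

definition c_ba :: "nat list \<Rightarrow> nat" where
  "c_ba p = card {(i, j). i < j \<and> Suc j < length p \<and> p ! Suc j < p ! j \<and> p ! j < p ! i}"

definition perm_complement :: "nat list \<Rightarrow> nat list" where
  "perm_complement p = map (\<lambda>x. length p + 1 - x) p"

definition stat_reversal :: "(nat list \<Rightarrow> nat) \<Rightarrow> nat list \<Rightarrow> nat" where
  "stat_reversal \<sigma> p = \<sigma> (rev p)"

definition stat_complement :: "(nat list \<Rightarrow> nat) \<Rightarrow> nat list \<Rightarrow> nat" where
  "stat_complement \<sigma> p = \<sigma> (perm_complement p)"

definition stat_reverse_complement :: "(nat list \<Rightarrow> nat) \<Rightarrow> nat list \<Rightarrow> nat" where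
  "stat_reverse_complement \<sigma> p = \<sigma> (rev (perm_complement p))"

definition stat_gf :: "(nat list \<Rightarrow> nat) \<Rightarrow> 'a::comm_ring_1 \<Rightarrow> nat \<Rightarrow> 'a" where
  "stat_gf \<sigma> q n = (\<Sum>p\<in>permutations_of_set {1..n}. q ^ \<sigma> p)"

(* tuples n >= t 1 > ... > t k >= 1; extensionality outside {1..k} makes each tuple
   occur exactly once *)
definition decr_tuples :: "nat \<Rightarrow> nat \<Rightarrow> (nat \<Rightarrow> nat) set" where
  "decr_tuples n k =
     {t \<in> {1..k} \<rightarrow>\<^sub>E {1..n}. \<forall>i\<in>{1..k}. \<forall>j\<in>{1..k}. i < j \<longrightarrow> t i > t j}"

(* only used for n, k >= 1 *)
definition coeff_a :: "'a::comm_ring_1 \<Rightarrow> nat \<Rightarrow> nat \<Rightarrow> 'a" where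
  "coeff_a q n k = (\<Sum>t\<in>decr_tuples n k. \<Prod>j=1..k - 1. (q ^ (n - t j) - 1))"

definition coeff_b :: "'a::comm_ring_1 \<Rightarrow> nat \<Rightarrow> nat \<Rightarrow> 'a" where
  "coeff_b q n k = (\<Sum>t\<in>decr_tuples n k. of_nat (t k) * (\<Prod>j=1..k. (q ^ (n - t j) - 1)))"

definition coeff_c :: "'a::comm_ring_1 \<Rightarrow> nat \<Rightarrow> nat \<Rightarrow> 'a" where
  "coeff_c q n k = (\<Sum>t\<in>decr_tuples n k. \<Prod>j=1..k. (q ^ (n - t j) - 1))"

end

theory Submission
  imports Defs "HOL-Library.Infinite_Set"
begin

text \<open>Writing \<open>l j\<close> for the number of entries to the left of \<open>p ! j\<close> that are larger than it,
  the weight of \<open>p\<close> is the product of the factors \<open>1 + (q ^ l j - 1)\<close> over its descents \<open>j\<close>.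
  Expand this product; each term is a choice of marked descents. If the last maximal block of
  entries joined by marked descents has \<open>k\<close> entries \<open>t 1 > \<dots> > t k\<close>, then every entry larger
  than \<open>t i\<close> lies to its left, so the block contributes the product of \<open>q ^ (n - t i) - 1\<close>
  over \<open>i < k\<close>, while the rest is an arbitrary arrangement of the other \<open>n - k\<close> entries. This is
  the recurrence. The identities for the coefficients come from splitting the \<open>k\<close>-subsets of
  \<open>{1..n}\<close> by whether they contain \<open>1\<close>.\<close>

subsection \<open>The coefficients as sums over subsets\<close>

definition subsets_of_card :: "nat \<Rightarrow> nat \<Rightarrow> nat set set" where
  "subsets_of_card n k = {S. S \<subseteq> {1..n} \<and> card S = k}"

lemma finite_subsets_of_card [simp]: "finite (subsets_of_card n k)"
  unfolding subsets_of_card_def by (rule finite_subset[of _ "Pow {1..n}"]) auto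

lemma subsets_of_cardD:
  assumes "S \<in> subsets_of_card n k"
  shows "finite S" "S \<subseteq> {1..n}" "card S = k" "0 \<notin> S"
  using assms finite_subset[of S "{1..n}"] by (auto simp: subsets_of_card_def)

text \<open>Splitting is at the element 1, not at the top element, because the remaining elements
  then shift down by one together with \<open>n\<close>. Since \<open>Suc n - Suc x = n - x\<close>,
  the weights \<open>q ^ (n - x) - 1\<close> survive the shift unchanged.\<close>

lemma subsets_of_card_Suc:
  "subsets_of_card (Suc n) (Suc k) =
     (`) Suc ` subsets_of_card n (Suc k) \<union> (\<lambda>S. insert 1 (Suc ` S)) ` subsets_of_card n k"
  (is "?L = ?A \<union> ?B")
proof (rule equalityI)
  show "?L \<subseteq> ?A \<union> ?B"
  proof
    fix S assume "S \<in> ?L"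
    then have S: "S \<subseteq> {1..Suc n}" "card S = Suc k" by (auto simp: subsets_of_card_def)
    \<comment> \<open>The condition \<open>x \<noteq> 0\<close> discards the element 1 of
      \<open>S\<close>, so one \<open>T\<close> serves both cases.\<close>
    define T where "T = {x. Suc x \<in> S \<and> x \<noteq> 0}"
    have im: "Suc ` T = S - {1}"
    proof (rule equalityI)
      show "S - {1} \<subseteq> Suc ` T"
      proof
        fix x assume x: "x \<in> S - {1}"
        then have "x \<noteq> 0" using S by auto
        then obtain y where "x = Suc y" by (cases x) auto
        then show "x \<in> Suc ` T" using x by (auto simp: T_def)
      qed
    qed (auto simp: T_def)
    have Tn: "T \<subseteq> {1..n}" using S by (auto simp: T_def)
    have cT: "card T = card (S - {1})" using im by (metis card_image inj_Suc)
    show "S \<in> ?A \<union> ?B"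
    proof (cases "1 \<in> S")
      case True
      then have "card T = k" using S cT by simp
      then have "T \<in> subsets_of_card n k" using Tn by (simp add: subsets_of_card_def)
      moreover have "S = insert 1 (Suc ` T)" using im True by auto
      ultimately show ?thesis by blast
    next
      case False
      then have "card T = Suc k" using S cT by simp
      then have "T \<in> subsets_of_card n (Suc k)" using Tn by (simp add: subsets_of_card_def)
      moreover have "S = Suc ` T" using im False by auto
      ultimately show ?thesis by blast
    qed
  qed
  have "?A \<subseteq> ?L"
    by (auto simp: subsets_of_card_def card_image)
  moreover have "?B \<subseteq> ?L"
  proof
    fix X assume "X \<in> ?B"
    then obtain S where S: "S \<in> subsets_of_card n k" "X = insert 1 (Suc ` S)" by auto
    note D = subsets_of_cardD[OF S(1)]
    have "1 \<notin> Suc ` S" using D by auto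
    then have "card X = Suc k" using D by (simp add: S(2) card_image)
    then show "X \<in> ?L" using D by (auto simp: subsets_of_card_def S(2))
  qed
  ultimately show "?A \<union> ?B \<subseteq> ?L" by blast
qed

lemma sum_subsets_of_card_Suc:
  fixes f :: "nat set \<Rightarrow> 'a::comm_monoid_add"
  shows "(\<Sum>S\<in>subsets_of_card (Suc n) (Suc k). f S) =
    (\<Sum>S\<in>subsets_of_card n (Suc k). f (Suc ` S)) +
    (\<Sum>S\<in>subsets_of_card n k. f (insert 1 (Suc ` S)))"
proof -
  have inj: "inj_on (\<lambda>S. insert 1 (Suc ` S)) (subsets_of_card n k)"
  proof (rule inj_onI)
    fix S T assume "S \<in> subsets_of_card n k" "T \<in> subsets_of_card n k"
      and eq: "insert 1 (Suc ` S) = insert 1 (Suc ` T)"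
    \<comment> \<open>As 0 lies outside both sets, 1 lies outside their shifted images and can be
      cancelled from both insertions.\<close>
    then have "0 \<notin> S" "0 \<notin> T" by (auto dest: subsets_of_cardD)
    then have "1 \<notin> Suc ` S" "1 \<notin> Suc ` T" by auto
    then have "Suc ` S = Suc ` T" using eq by (metis insert_ident)
    then show "S = T" by (simp add: inj_image_eq_iff)
  qed
  have inj_Suc_image: "inj_on ((`) Suc) (subsets_of_card n (Suc k))"
    by (auto simp: inj_on_def inj_image_eq_iff)
  have "1 \<notin> Suc ` S" if "S \<in> subsets_of_card n (Suc k)" for S
    using subsets_of_cardD(4)[OF that] by auto
  then have disj: "(`) Suc ` subsets_of_card n (Suc k) \<inter>
      (\<lambda>S. insert 1 (Suc ` S)) ` subsets_of_card n k = {}" by blast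
  show ?thesis
    unfolding subsets_of_card_Suc
    by (subst sum.union_disjoint)
      (use disj in \<open>simp_all only: sum.reindex[OF inj] sum.reindex[OF inj_Suc_image] o_def
        finite_imageI finite_subsets_of_card\<close>)
qed

lemma decr_tuples_inj_on: "t \<in> decr_tuples n k \<Longrightarrow> inj_on t {1..k}"
  unfolding decr_tuples_def by (rule linorder_inj_onI) (fastforce dest: less_imp_neq)+

text \<open>A strictly decreasing tuple is determined by the set of its entries, and its last entry
  is the minimum of that set. The summand \<open>f\<close> sees both, which covers all three
  coefficients at once.\<close>

lemma sum_decr_tuples:
  fixes f :: "nat set \<Rightarrow> nat \<Rightarrow> 'a::comm_monoid_add"
  assumes "k \<ge> 1"
  shows "(\<Sum>t\<in>decr_tuples n k. f (t ` {1..k}) (t k)) = (\<Sum>S\<in>subsets_of_card n k. f S (Min S))"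
proof -
  \<comment> \<open>The inverse map lists \<open>S\<close> in decreasing order. The shift by 1
    reconciles tuples indexed from 1 with lists indexed from 0, and the restriction to
    \<open>{1..k}\<close> supplies the required extensionality.\<close>
  define h where "h S = (\<lambda>i\<in>{1..k}. rev (sorted_list_of_set S) ! (i - 1))" for S :: "nat set"
  have MinS: "Min (t ` {1..k}) = t k" if "t \<in> decr_tuples n k" for t
  proof (rule Min_eqI)
    fix y assume "y \<in> t ` {1..k}"
    then obtain i where "i \<in> {1..k}" "y = t i" by auto
    then show "t k \<le> y" using that assms by (cases "i = k") (auto simp: decr_tuples_def intro!: less_imp_le)
  qed (use assms in auto)
  have nth_h: "h S i = rev (sorted_list_of_set S) ! (i - 1)" if "i \<in> {1..k}" for S i
    using that by (simp add: h_def)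
  have hS: "h S ` {1..k} = S" if S: "S \<in> subsets_of_card n k" for S
  proof -
    note D = subsets_of_cardD[OF S]
    have "h S ` {1..k} = (\<lambda>i. rev (sorted_list_of_set S) ! (i - 1)) ` {1..k}"
      by (rule image_cong) (auto simp: nth_h)
    also have "\<dots> = (!) (rev (sorted_list_of_set S)) ` ((\<lambda>i. i - 1) ` {1..k})"
      by (simp add: image_image)
    also have "(\<lambda>i. i - 1) ` {1..k} = {0..<k}"
      by (force simp: image_iff intro!: bexI[of _ "Suc _"])
    also have "(!) (rev (sorted_list_of_set S)) ` {0..<k} = set (rev (sorted_list_of_set S))"
      using D nth_image[of k "rev (sorted_list_of_set S)"] by (simp add: atLeast0LessThan)
    finally show ?thesis using D by simp
  qed
  have ht: "h S \<in> decr_tuples n k" if S: "S \<in> subsets_of_card n k" for S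
  proof -
    note D = subsets_of_cardD[OF S]
    have "sorted_wrt (>) (rev (sorted_list_of_set S))"
      using D by (simp add: sorted_wrt_rev)
    then have "h S i > h S j" if "i \<in> {1..k}" "j \<in> {1..k}" "i < j" for i j
      using that D by (subst (1 2) nth_h) (auto simp: sorted_wrt_iff_nth_less)
    moreover have "h S i \<in> {1..n}" if "i \<in> {1..k}" for i
      using hS[OF S] D(2) that by blast
    then have "h S \<in> {1..k} \<rightarrow>\<^sub>E {1..n}"
      by (simp add: h_def PiE_iff)
    ultimately show ?thesis by (simp add: decr_tuples_def)
  qed
  have th: "h (t ` {1..k}) = t" if t: "t \<in> decr_tuples n k" for t
  proof -
    let ?l = "map t [1..<Suc k]"
    have "sorted_wrt (>) ?l"
      using t by (simp add: sorted_wrt_iff_nth_less decr_tuples_def del: upt_Suc)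
    then have "sorted_wrt (<) (rev ?l)" by (simp only: sorted_wrt_rev)
    then have "sorted_list_of_set (set (rev ?l)) = rev ?l"
      unfolding strict_sorted_iff by (intro sorted_list_of_set.idem_if_sorted_distinct) auto
    moreover have "set (rev ?l) = t ` {1..k}" by auto
    ultimately have "rev (sorted_list_of_set (t ` {1..k})) = ?l" by (metis rev_rev_ident)
    then show ?thesis using t
      by (auto simp: h_def fun_eq_iff decr_tuples_def PiE_iff extensional_def simp del: upt_Suc)
  qed
  show ?thesis
  proof (rule sum.reindex_bij_witness[where i = h and j = "\<lambda>t. t ` {1..k}"])
    fix t assume t: "t \<in> decr_tuples n k"
    then show "t ` {1..k} \<in> subsets_of_card n k"
      using decr_tuples_inj_on[OF t] by (auto simp: subsets_of_card_def card_image decr_tuples_def)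
  qed (simp_all only: th ht hS MinS)
qed

lemma coeff_b_conv_subsets:
  assumes "k \<ge> 1"
  shows "coeff_b q n k =
    (\<Sum>S\<in>subsets_of_card n k. of_nat (Min S) * (\<Prod>x\<in>S. q ^ (n - x) - 1))"
proof -
  have "coeff_b q n k =
      (\<Sum>t\<in>decr_tuples n k. of_nat (t k) * (\<Prod>x\<in>t ` {1..k}. q ^ (n - x) - 1))"
    unfolding coeff_b_def
    by (rule sum.cong) (simp_all only: prod.reindex[OF decr_tuples_inj_on] o_def)
  also have "\<dots> = (\<Sum>S\<in>subsets_of_card n k. of_nat (Min S) * (\<Prod>x\<in>S. q ^ (n - x) - 1))"
    by (rule sum_decr_tuples[OF assms])
  finally show ?thesis .
qed

lemma subsets_of_card_zero: "subsets_of_card n 0 = {{}}"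
  by (auto simp: subsets_of_card_def dest: finite_subset)

text \<open>Here \<open>k = 0\<close> must be included, with both sides equal to 1: the recurrences
  express the coefficients b and c at index 1 through c at index 0.\<close>

lemma coeff_c_conv_subsets:
  "coeff_c q n k = (\<Sum>S\<in>subsets_of_card n k. \<Prod>x\<in>S. q ^ (n - x) - 1)"
proof (cases "k = 0")
  case True
  then show ?thesis
    by (simp add: coeff_c_def decr_tuples_def subsets_of_card_zero)
next
  case False
  then have "k \<ge> 1" by simp
  have "coeff_c q n k = (\<Sum>t\<in>decr_tuples n k. \<Prod>x\<in>t ` {1..k}. q ^ (n - x) - 1)"
    unfolding coeff_c_def
    by (rule sum.cong) (simp_all only: prod.reindex[OF decr_tuples_inj_on] o_def)
  also have "\<dots> = (\<Sum>S\<in>subsets_of_card n k. \<Prod>x\<in>S. q ^ (n - x) - 1)"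
    by (rule sum_decr_tuples[OF \<open>k \<ge> 1\<close>])
  finally show ?thesis .
qed

text \<open>The product in \<open>coeff_a\<close> stops at \<open>k - 1\<close>, so exactly the
  factor of the smallest entry is missing.\<close>

lemma coeff_a_conv_subsets:
  assumes "k \<ge> 1"
  shows "coeff_a q n k = (\<Sum>S\<in>subsets_of_card n k. \<Prod>x\<in>S - {Min S}. q ^ (n - x) - 1)"
proof -
  have "(\<Prod>j=1..k - 1. q ^ (n - t j) - 1) = (\<Prod>x\<in>t ` {1..k} - {t k}. q ^ (n - x) - 1)"
    if "t \<in> decr_tuples n k" for t
  proof -
    have inj: "inj_on t {1..k}" by (rule decr_tuples_inj_on[OF that])
    have "t ` {1..k} - {t k} = t ` ({1..k} - {k})"
      using inj assms by (subst inj_on_image_set_diff[OF inj]) auto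
    also have "{1..k} - {k} = {1..k - 1}" using assms by auto
    finally show ?thesis
      by (simp add: prod.reindex inj_on_subset[OF inj])
  qed
  then have "coeff_a q n k =
      (\<Sum>t\<in>decr_tuples n k. \<Prod>x\<in>t ` {1..k} - {t k}. q ^ (n - x) - 1)"
    unfolding coeff_a_def by (intro sum.cong) auto
  also have "\<dots> = (\<Sum>S\<in>subsets_of_card n k. \<Prod>x\<in>S - {Min S}. q ^ (n - x) - 1)"
    by (rule sum_decr_tuples[OF assms])
  finally show ?thesis .
qed

section \<open>Recurrences for the coefficients\<close>

lemma Min_image_Suc: "finite S \<Longrightarrow> S \<noteq> {} \<Longrightarrow> Min (Suc ` S) = Suc (Min S)"
  by (simp add: mono_Min_commute[symmetric] mono_Suc)

lemma Min_insert_one: "finite S \<Longrightarrow> Min (insert 1 (Suc ` S)) = (1::nat)"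
  by (rule Min_eqI) auto

text \<open>Sets without 1 are shifted sets of the same size and weight; in the others the element 1
  contributes the factor \<open>q ^ n - 1\<close>.\<close>

lemma coeff_c_rec:
  "coeff_c q (Suc n) (Suc k) = coeff_c q n (Suc k) + (q ^ n - 1) * coeff_c q n k"
proof -
  have "(\<Prod>x\<in>insert 1 (Suc ` S). q ^ (Suc n - x) - 1) =
      (q ^ n - 1) * (\<Prod>x\<in>S. q ^ (n - x) - 1)" if "S \<in> subsets_of_card n k" for S
    using subsets_of_cardD[OF that] by (subst prod.insert) (auto simp: prod.reindex)
  then show ?thesis
    by (simp add: coeff_c_conv_subsets sum_subsets_of_card_Suc prod.reindex sum_distrib_left)
qed

text \<open>Shifting a set raises its minimum by one, which produces the extra c term. A set
  containing 1 has minimum 1 and so contributes as it does for c.\<close>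

lemma coeff_b_rec:
  "coeff_b q (Suc n) (Suc k) =
    coeff_b q n (Suc k) + coeff_c q n (Suc k) + (q ^ n - 1) * coeff_c q n k"
proof -
  have 1: "of_nat (Min (insert 1 (Suc ` S))) * (\<Prod>x\<in>insert 1 (Suc ` S). q ^ (Suc n - x) - 1) =
      (q ^ n - 1) * (\<Prod>x\<in>S. q ^ (n - x) - 1)" if "S \<in> subsets_of_card n k" for S
    using subsets_of_cardD[OF that]
    by (subst prod.insert; (subst Min_insert_one)?) (auto simp: prod.reindex)
  have 2: "of_nat (Min (Suc ` S)) * (\<Prod>x\<in>Suc ` S. q ^ (Suc n - x) - 1) =
      of_nat (Min S) * (\<Prod>x\<in>S. q ^ (n - x) - 1) + (\<Prod>x\<in>S. q ^ (n - x) - 1)"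
    if "S \<in> subsets_of_card n (Suc k)" for S
  proof -
    have "S \<noteq> {}" using subsets_of_cardD[OF that] by auto
    then show ?thesis using subsets_of_cardD[OF that]
      by (simp add: Min_image_Suc prod.reindex algebra_simps)
  qed
  have "coeff_b q (Suc n) (Suc k) =
      (\<Sum>S\<in>subsets_of_card n (Suc k).
        of_nat (Min (Suc ` S)) * (\<Prod>x\<in>Suc ` S. q ^ (Suc n - x) - 1)) +
      (\<Sum>S\<in>subsets_of_card n k. of_nat (Min (insert 1 (Suc ` S))) *
        (\<Prod>x\<in>insert 1 (Suc ` S). q ^ (Suc n - x) - 1))"
    by (subst coeff_b_conv_subsets) (simp_all only: sum_subsets_of_card_Suc)
  also have "\<dots> = (\<Sum>S\<in>subsets_of_card n (Suc k).
        of_nat (Min S) * (\<Prod>x\<in>S. q ^ (n - x) - 1) + (\<Prod>x\<in>S. q ^ (n - x) - 1)) +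
      (\<Sum>S\<in>subsets_of_card n k. (q ^ n - 1) * (\<Prod>x\<in>S. q ^ (n - x) - 1))"
    by (intro arg_cong2[where f = "(+)"] sum.cong refl 1 2)
  finally show ?thesis
    by (simp add: coeff_b_conv_subsets coeff_c_conv_subsets sum.distrib sum_distrib_left)
qed

text \<open>For a set containing 1, the omitted factor is that of 1 itself, so the full product over
  the shifted rest remains and no power of \<open>q\<close> is split off.\<close>

lemma coeff_a_rec:
  "coeff_a q (Suc n) (Suc k) = coeff_a q n (Suc k) + coeff_c q n k"
proof -
  have 1: "(\<Prod>x\<in>insert 1 (Suc ` S) - {Min (insert 1 (Suc ` S))}. q ^ (Suc n - x) - 1) =
      (\<Prod>x\<in>S. q ^ (n - x) - 1)" if "S \<in> subsets_of_card n k" for S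
  proof -
    have "insert 1 (Suc ` S) - {1} = Suc ` S"
      using subsets_of_cardD[OF that] by auto
    then show ?thesis
      using subsets_of_cardD(1)[OF that] by (simp only: Min_insert_one) (simp add: prod.reindex)
  qed
  have 2: "(\<Prod>x\<in>Suc ` S - {Min (Suc ` S)}. q ^ (Suc n - x) - 1) =
      (\<Prod>x\<in>S - {Min S}. q ^ (n - x) - 1)" if "S \<in> subsets_of_card n (Suc k)" for S
  proof -
    have "S \<noteq> {}" using subsets_of_cardD[OF that] by auto
    then have "Min (Suc ` S) = Suc (Min S)"
      using subsets_of_cardD(1)[OF that] by (rule Min_image_Suc[rotated])
    then have "Suc ` S - {Min (Suc ` S)} = Suc ` (S - {Min S})" by auto
    then show ?thesis by (simp add: prod.reindex)
  qed
  have "coeff_a q (Suc n) (Suc k) =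
      (\<Sum>S\<in>subsets_of_card n (Suc k).
        \<Prod>x\<in>Suc ` S - {Min (Suc ` S)}. q ^ (Suc n - x) - 1) +
      (\<Sum>S\<in>subsets_of_card n k.
        \<Prod>x\<in>insert 1 (Suc ` S) - {Min (insert 1 (Suc ` S))}. q ^ (Suc n - x) - 1)"
    by (subst coeff_a_conv_subsets) (simp_all only: sum_subsets_of_card_Suc)
  also have "\<dots> = (\<Sum>S\<in>subsets_of_card n (Suc k). \<Prod>x\<in>S - {Min S}. q ^ (n - x) - 1) +
      (\<Sum>S\<in>subsets_of_card n k. \<Prod>x\<in>S. q ^ (n - x) - 1)"
    by (intro arg_cong2[where f = "(+)"] sum.cong refl 1 2)
  finally show ?thesis
    by (simp add: coeff_a_conv_subsets coeff_c_conv_subsets)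
qed

lemma subsets_of_card_0: "k \<ge> 1 \<Longrightarrow> subsets_of_card 0 k = {}"
  by (auto simp: subsets_of_card_def)

text \<open>Both sides have the same increment in \<open>n\<close>: the recurrences for b and c
  combine to give b the increment \<open>coeff_c q (Suc n) k\<close>, which is also that of a by
  \<open>coeff_a_rec\<close>. For \<open>n = 0\<close> every sum involved is empty.\<close>

lemma coeff_a_eq_coeff_b:
  assumes "k \<ge> 1"
  shows "coeff_a q (Suc n) (Suc k) = coeff_b q n k"
proof (induction n)
  case 0
  have "coeff_a q (Suc 0) (Suc k) = coeff_a q 0 (Suc k) + coeff_c q 0 k"
    by (rule coeff_a_rec)
  then show ?case
    using assms by (simp add: coeff_a_conv_subsets coeff_b_conv_subsets coeff_c_conv_subsets
        subsets_of_card_0)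
next
  case (Suc n)
  obtain l where "k = Suc l" using assms by (cases k) auto
  then have "coeff_b q (Suc n) k = coeff_b q n k + coeff_c q (Suc n) k"
    by (simp add: coeff_b_rec coeff_c_rec)
  then show ?case
    using Suc coeff_a_rec[of q "Suc n" k] by simp
qed

subsection \<open>Marked descents\<close>

text \<open>The value 0 at a non-descent serves two purposes: \<open>1 + desc_factor\<close> is the
  correct weight at every position, and a product over a block of positions vanishes unless all of
  them are descents.\<close>

definition desc_factor :: "'a::comm_ring_1 \<Rightarrow> nat list \<Rightarrow> nat \<Rightarrow> 'a" where
  "desc_factor q p j =
     (if p ! Suc j < p ! j then q ^ card {i. i < j \<and> p ! j < p ! i} - 1 else 0)"

lemma c_ba_eq_sum:
  "c_ba p = (\<Sum>j<length p - 1. if p ! Suc j < p ! j then card {i. i < j \<and> p ! j < p ! i} else 0)"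
proof -
  let ?J = "{j. j < length p - 1 \<and> p ! Suc j < p ! j}"
  have "{(i, j). i < j \<and> Suc j < length p \<and> p ! Suc j < p ! j \<and> p ! j < p ! i} =
      prod.swap ` (SIGMA j:?J. {i. i < j \<and> p ! j < p ! i})"
    by (force simp: image_iff)
  then have "c_ba p = card (SIGMA j:?J. {i. i < j \<and> p ! j < p ! i})"
    unfolding c_ba_def by (simp add: card_image)
  also have "\<dots> = (\<Sum>j\<in>?J. card {i. i < j \<and> p ! j < p ! i})"
    by (rule card_SigmaI) auto
  also have "\<dots> = (\<Sum>j<length p - 1.
      if p ! Suc j < p ! j then card {i. i < j \<and> p ! j < p ! i} else 0)"
    by (subst sum.inter_filter[symmetric]) (auto intro!: sum.cong)
  finally show ?thesis .
qed

text \<open>The factor at \<open>j\<close> looks only at entries up to position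
  \<open>Suc j\<close>, so a prefix has the same factors as the whole word. Prefixes arise as what
  precedes the last block.\<close>

lemma power_c_ba_take:
  assumes "m \<le> length p"
  shows "q ^ c_ba (take m p) = (\<Prod>j<m - 1. 1 + desc_factor q p j)"
proof -
  have *: "{i. i < j \<and> p ! j < take m p ! i} = {i. i < j \<and> p ! j < p ! i}" if "j < m" for j
    using that by auto
  have "q ^ c_ba (take m p) = (\<Prod>j<m - 1.
      q ^ (if take m p ! Suc j < take m p ! j
           then card {i. i < j \<and> take m p ! j < take m p ! i} else 0))"
    using assms by (simp add: c_ba_eq_sum power_sum min_absorb2)
  also have "\<dots> = (\<Prod>j<m - 1. 1 + desc_factor q p j)"
    by (rule prod.cong) (auto simp: desc_factor_def *)
  finally show ?thesis .
qed

text \<open>In the expansion of the product, terms are grouped by the length \<open>k + 1\<close> of the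
  last maximal block of positions joined by chosen factors \<open>y j\<close>.\<close>

lemma prod_one_plus_last_block:
  fixes y :: "nat \<Rightarrow> 'a::comm_ring_1"
  shows "(\<Prod>j<m. 1 + y j) = (\<Sum>k\<le>m. (\<Prod>j\<in>{m - k..<m}. y j) * (\<Prod>j<m - k - 1. 1 + y j))"
proof (induction m)
  case (Suc m)
  \<comment> \<open>The term \<open>k = 0\<close> leaves position \<open>m\<close> unmarked; all
    other terms contain \<open>y m\<close>, and factoring it out leaves the sum of the induction
    hypothesis.\<close>
  have "(\<Sum>k\<le>Suc m. (\<Prod>j\<in>{Suc m - k..<Suc m}. y j) * (\<Prod>j<Suc m - k - 1. 1 + y j)) =
      (\<Prod>j<m. 1 + y j) +
      (\<Sum>k\<le>m. (\<Prod>j\<in>{m - k..<Suc m}. y j) * (\<Prod>j<m - k - 1. 1 + y j))"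
    by (subst sum.atMost_Suc_shift) simp
  also have "(\<Sum>k\<le>m. (\<Prod>j\<in>{m - k..<Suc m}. y j) * (\<Prod>j<m - k - 1. 1 + y j)) =
      (\<Sum>k\<le>m. y m * ((\<Prod>j\<in>{m - k..<m}. y j) * (\<Prod>j<m - k - 1. 1 + y j)))"
    by (rule sum.cong) (auto simp: prod.atLeastLessThan_Suc mult_ac)
  also have "\<dots> = y m * (\<Prod>j<m. 1 + y j)"
    by (simp only: Suc.IH sum_distrib_left[symmetric])
  finally show ?case by (simp add: algebra_simps)
qed simp

lemma power_c_ba_last_block:
  assumes "length p = n" "n \<ge> 1"
  shows "q ^ c_ba p =
    (\<Sum>k=1..n. (\<Prod>j\<in>{n - k..<n - 1}. desc_factor q p j) * q ^ c_ba (take (n - k) p))"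
proof -
  obtain m where n: "n = Suc m" using assms by (cases n) auto
  have "q ^ c_ba p = (\<Prod>j<m. 1 + desc_factor q p j)"
    using power_c_ba_take[of n p q] assms n by simp
  also have "\<dots> = (\<Sum>k\<le>m. (\<Prod>j\<in>{m - k..<m}. desc_factor q p j) *
      (\<Prod>j<m - k - 1. 1 + desc_factor q p j))"
    by (rule prod_one_plus_last_block)
  \<comment> \<open>Position \<open>m - k - 1\<close> is unmarked and contributes 1, so the
    remaining free factors are exactly those of the prefix of length \<open>m - k\<close>.\<close>
  also have "\<dots> = (\<Sum>k\<le>m. (\<Prod>j\<in>{m - k..<m}. desc_factor q p j) * q ^ c_ba (take (m - k) p))"
    using assms n by (simp add: power_c_ba_take)
  \<comment> \<open>A run of \<open>k\<close> marked descents joins \<open>k + 1\<close> entries;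
    from here on \<open>k\<close> counts entries.\<close>
  also have "\<dots> = (\<Sum>k=1..n.
      (\<Prod>j\<in>{n - k..<n - 1}. desc_factor q p j) * q ^ c_ba (take (n - k) p))"
    using sum.shift_bounds_cl_Suc_ivl[of
        "\<lambda>k. (\<Prod>j\<in>{n - k..<n - 1}. desc_factor q p j) * q ^ c_ba (take (n - k) p)" 0 m]
    by (simp add: n atMost_atLeast0)
  finally show ?thesis .
qed

section \<open>Permutations ending in a decreasing block\<close>

definition decr_from :: "nat \<Rightarrow> nat list \<Rightarrow> bool" where
  "decr_from m p \<longleftrightarrow> sorted_wrt (>) (drop m p)"

text \<open>By transitivity adjacent comparisons suffice, and these are the ones that
  \<open>desc_factor\<close> tests.\<close>

lemma decr_from_iff:
  "decr_from m p \<longleftrightarrow> (\<forall>j\<in>{m..<length p - 1}. p ! Suc j < p ! j)"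
proof -
  have "decr_from m p \<longleftrightarrow> (\<forall>i. Suc (m + i) < length p \<longrightarrow> p ! Suc (m + i) < p ! (m + i))"
    unfolding decr_from_def
    by (subst sorted_wrt_iff_nth_Suc_transp) (auto simp: less_diff_conv add.commute)
  also have "\<dots> \<longleftrightarrow> (\<forall>j\<in>{m..<length p - 1}. p ! Suc j < p ! j)"
    by (auto simp: less_diff_conv) (metis add.commute le_Suc_ex)
  finally show ?thesis .
qed

lemma decr_from_nth_less:
  assumes "decr_from m p" "m \<le> i" "i < j" "j < length p"
  shows "p ! j < p ! i"
proof -
  have "drop m p ! (i - m) > drop m p ! (j - m)"
    using assms(1) unfolding decr_from_def
    by (rule sorted_wrt_nth_less) (use assms in auto)
  then show ?thesis using assms by simp
qed

text \<open>For an entry \<open>p ! j\<close> of a final decreasing block, all of the \<open>n - p ! j\<close> larger entries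
  lie to its left.\<close>

lemma prod_desc_factor_decr:
  assumes p: "p \<in> permutations_of_set {1..n}" and k: "1 \<le> k" "k \<le> n"
    and decr: "decr_from (n - k) p"
  shows "(\<Prod>j\<in>{n - k..<n - 1}. desc_factor q p j) =
    (\<Prod>x\<in>set (drop (n - k) p) - {Min (set (drop (n - k) p))}. q ^ (n - x) - 1)"
proof -
  have len: "length p = n" and dist: "distinct p" and setp: "set p = {1..n}"
    using p length_finite_permutations_of_set[OF p] by (auto dest: permutations_of_setD)
  have factor: "desc_factor q p j = q ^ (n - p ! j) - 1" if j: "j \<in> {n - k..<n - 1}" for j
  proof -
    have "(!) p ` {i. i < j \<and> p ! j < p ! i} = {p ! j<..n}"
    proof (intro equalityI subsetI)
      fix x assume "x \<in> (!) p ` {i. i < j \<and> p ! j < p ! i}"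
      then obtain i where "i < j" "p ! j < p ! i" "x = p ! i" by auto
      moreover from this have "p ! i \<in> set p" using j len by (intro nth_mem) auto
      ultimately show "x \<in> {p ! j<..n}" by (simp add: setp)
    next
      fix x assume x: "x \<in> {p ! j<..n}"
      then have "x \<in> set p" by (auto simp: setp)
      then obtain i where i: "i < n" "p ! i = x" by (auto simp: in_set_conv_nth len)
      \<comment> \<open>An entry at or after position \<open>j\<close> belongs to the decreasing
        block and cannot exceed \<open>p ! j\<close>.\<close>
      have "\<not> j \<le> i"
        using decr_from_nth_less[OF decr, of j i] i x j len by (cases "i = j") auto
      then show "x \<in> (!) p ` {i. i < j \<and> p ! j < p ! i}" using i x by auto
    qed
    moreover have "inj_on ((!) p) {i. i < j \<and> p ! j < p ! i}"
      using dist j len by (auto intro!: inj_on_nth)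
    ultimately have "card {i. i < j \<and> p ! j < p ! i} = n - p ! j"
      by (metis card_image card_greaterThanAtMost)
    moreover have "p ! Suc j < p ! j"
      using decr j len by (auto simp: decr_from_iff)
    ultimately show ?thesis by (simp add: desc_factor_def)
  qed
  have set_drop: "set (drop (n - k) p) = (!) p ` {n - k..<n}"
  proof -
    have "drop (n - k) p = map ((!) p) [n - k..<n]"
      by (rule nth_equalityI) (auto simp: len)
    then show ?thesis by simp
  qed
  have inj: "inj_on ((!) p) A" if "A \<subseteq> {..<n}" for A
    using dist that len by (auto intro!: inj_on_nth)
  \<comment> \<open>The last position carries no descent factor, and its entry is the minimum of the
    block; this accounts for the element removed from the product.\<close>
  have "Min ((!) p ` {n - k..<n}) = p ! (n - 1)"
  proof (rule Min_eqI)
    fix y assume "y \<in> (!) p ` {n - k..<n}"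
    then obtain i where i: "n - k \<le> i" "i < n" "y = p ! i" by auto
    then consider "i = n - 1" | "i < n - 1" by linarith
    then show "p ! (n - 1) \<le> y"
      using decr_from_nth_less[OF decr, of i "n - 1"] i len by cases auto
  qed (use k in auto)
  moreover have "(!) p ` {n - k..<n} - {p ! (n - 1)} = (!) p ` ({n - k..<n} - {n - 1})"
    using k by (subst inj_on_image_set_diff[OF inj[of "{..<n}"]]) auto
  moreover have "{n - k..<n} - {n - 1} = {n - k..<n - 1}" by auto
  ultimately have "set (drop (n - k) p) - {Min (set (drop (n - k) p))} = (!) p ` {n - k..<n - 1}"
    by (simp add: set_drop)
  moreover have "inj_on ((!) p) {n - k..<n - 1}" by (rule inj) auto
  ultimately show ?thesis
    by (simp only: prod.reindex o_def factor cong: prod.cong)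
qed

lemma prod_desc_factor_not_decr:
  assumes "length p = n" "\<not> decr_from (n - k) p"
  shows "(\<Prod>j\<in>{n - k..<n - 1}. desc_factor q p j) = 0"
proof -
  obtain j where "j \<in> {n - k..<n - 1}" "\<not> p ! Suc j < p ! j"
    using assms by (auto simp: decr_from_iff)
  then show ?thesis
    by (intro prod_zero) (auto simp: desc_factor_def intro!: bexI[of _ j])
qed

text \<open>The final block is recovered from its set of entries by writing them in decreasing
  order, while the prefix may be any arrangement of the complement.\<close>

lemma sum_decr_from:
  fixes f :: "nat set \<Rightarrow> nat list \<Rightarrow> 'a::comm_monoid_add"
  assumes "k \<le> n"
  shows "(\<Sum>p | p \<in> permutations_of_set {1..n} \<and> decr_from (n - k) p.
      f (set (drop (n - k) p)) (take (n - k) p)) =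
    (\<Sum>S\<in>subsets_of_card n k. \<Sum>u\<in>permutations_of_set ({1..n} - S). f S u)"
proof -
  have "(\<Sum>p | p \<in> permutations_of_set {1..n} \<and> decr_from (n - k) p.
      f (set (drop (n - k) p)) (take (n - k) p)) =
    (\<Sum>(S, u)\<in>(SIGMA S:subsets_of_card n k. permutations_of_set ({1..n} - S)). f S u)"
  proof (rule sum.reindex_bij_witness[where
        i = "\<lambda>(S, u). u @ rev (sorted_list_of_set S)" and
        j = "\<lambda>p. (set (drop (n - k) p), take (n - k) p)"])
    fix p assume "p \<in> {p \<in> permutations_of_set {1..n}. decr_from (n - k) p}"
    then have p: "p \<in> permutations_of_set {1..n}" and decr: "decr_from (n - k) p" by auto
    have len: "length p = n" and dist: "distinct p" and setp: "set p = {1..n}"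
      using p length_finite_permutations_of_set[OF p] by (auto dest: permutations_of_setD)
    have "sorted_wrt (<) (rev (drop (n - k) p))"
      using decr by (simp add: decr_from_def sorted_wrt_rev)
    then have "sorted_list_of_set (set (rev (drop (n - k) p))) = rev (drop (n - k) p)"
      unfolding strict_sorted_iff by (intro sorted_list_of_set.idem_if_sorted_distinct) auto
    then show "(case (set (drop (n - k) p), take (n - k) p) of
        (S, u) \<Rightarrow> u @ rev (sorted_list_of_set S)) = p"
      by simp
    have disj: "set (take (n - k) p) \<inter> set (drop (n - k) p) = {}"
      and un: "set (take (n - k) p) \<union> set (drop (n - k) p) = {1..n}"
      using dist setp by (metis append_take_drop_id distinct_append)
        (metis append_take_drop_id set_append setp)
    have "card (set (drop (n - k) p)) = k"
      using dist len assms by (simp add: distinct_card)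
    then have "set (drop (n - k) p) \<in> subsets_of_card n k"
      using un by (auto simp: subsets_of_card_def)
    moreover have "take (n - k) p \<in> permutations_of_set ({1..n} - set (drop (n - k) p))"
      using disj un dist by (intro permutations_of_setI) auto
    ultimately show "(set (drop (n - k) p), take (n - k) p) \<in>
        (SIGMA S:subsets_of_card n k. permutations_of_set ({1..n} - S))"
      by simp
  next
    fix a assume "a \<in> (SIGMA S:subsets_of_card n k. permutations_of_set ({1..n} - S))"
    then obtain S u where a: "a = (S, u)" and S: "S \<in> subsets_of_card n k"
      and u: "u \<in> permutations_of_set ({1..n} - S)" by auto
    note D = subsets_of_cardD[OF S]
    have lu: "length u = n - k"
      using length_finite_permutations_of_set[OF u] D by (simp add: card_Diff_subset)
    have setu: "set u = {1..n} - S" and distu: "distinct u"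
      using u by (auto dest: permutations_of_setD)
    show "(set (drop (n - k) (case a of (S, u) \<Rightarrow> u @ rev (sorted_list_of_set S))),
        take (n - k) (case a of (S, u) \<Rightarrow> u @ rev (sorted_list_of_set S))) = a"
      using lu D by (simp add: a)
    have "decr_from (n - k) (u @ rev (sorted_list_of_set S))"
      using lu D by (simp add: decr_from_def sorted_wrt_rev)
    moreover have "u @ rev (sorted_list_of_set S) \<in> permutations_of_set {1..n}"
      using D setu distu by (intro permutations_of_setI) auto
    ultimately show "(case a of (S, u) \<Rightarrow> u @ rev (sorted_list_of_set S)) \<in>
        {p \<in> permutations_of_set {1..n}. decr_from (n - k) p}"
      by (simp add: a)
  qed auto
  then show ?thesis by (simp add: sum.Sigma)
qed

section \<open>Standardisation and the recurrence for the generating function\<close>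

lemma c_ba_map:
  assumes "strict_mono_on A f" "set p \<subseteq> A"
  shows "c_ba (map f p) = c_ba p"
proof -
  have less: "map f p ! i < map f p ! j \<longleftrightarrow> p ! i < p ! j" if "i < length p" "j < length p" for i j
    using that assms by (auto simp: strict_mono_on_less subset_eq)
  have "{(i, j). i < j \<and> Suc j < length (map f p) \<and> map f p ! Suc j < map f p ! j \<and>
      map f p ! j < map f p ! i} =
    {(i, j). i < j \<and> Suc j < length p \<and> p ! Suc j < p ! j \<and> p ! j < p ! i}"
    using less by auto
  then show ?thesis by (simp only: c_ba_def)
qed

text \<open>Only relative order matters for \<open>c_ba\<close>, so the entries of \<open>A\<close>
  can be relabelled increasingly by \<open>{1..card A}\<close>.\<close>

lemma sum_power_c_ba_card:
  assumes "finite A"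
  shows "(\<Sum>p\<in>permutations_of_set A. q ^ c_ba p) = stat_gf c_ba q (card A)"
proof -
  obtain h where h: "bij_betw h {..<card A} A" "strict_mono_on {..<card A} h"
    using ex_bij_betw_strict_mono_card[OF assms] .
  \<comment> \<open>The enumeration \<open>h\<close> starts at 0, whereas permutations use the
    letters from 1.\<close>
  define f where "f x = h (x - 1)" for x
  have "bij_betw (\<lambda>x. x - 1) {1..card A} {..<card A}"
    by (rule bij_betw_byWitness[where f' = Suc]) auto
  then have bij: "bij_betw f {1..card A} A"
    unfolding f_def using bij_betw_trans[OF _ h(1)] by (simp add: o_def)
  have mono: "strict_mono_on {1..card A} f"
    by (auto simp: f_def intro!: strict_mono_onI strict_mono_onD[OF h(2)])
  have "permutations_of_set A = map f ` permutations_of_set {1..card A}"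
    using permutations_of_set_image_inj[OF bij_betw_imp_inj_on[OF bij]] bij_betw_imp_surj_on[OF bij]
    by simp
  moreover have "inj_on (map f) (permutations_of_set {1..card A})"
    using bij_betw_imp_inj_on[OF bij]
    by (intro inj_on_mapI) (auto simp: permutations_of_set_def intro: inj_on_subset)
  ultimately have "(\<Sum>p\<in>permutations_of_set A. q ^ c_ba p) =
      (\<Sum>p\<in>permutations_of_set {1..card A}. q ^ c_ba (map f p))"
    by (simp add: sum.reindex)
  also have "\<dots> = stat_gf c_ba q (card A)"
    unfolding stat_gf_def
    by (rule sum.cong) (auto simp: c_ba_map[OF mono] dest: permutations_of_setD)
  finally show ?thesis .
qed

lemma stat_gf_c_ba_rec:
  fixes q :: "'a::comm_ring_1"
  assumes "n \<ge> 1"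
  shows "stat_gf c_ba q n = (\<Sum>k=1..n. coeff_a q n k * stat_gf c_ba q (n - k))"
proof -
  let ?P = "permutations_of_set {1..n}"
  let ?D = "\<lambda>k p. \<Prod>j\<in>{n - k..<n - 1}. desc_factor q p j"
  have len: "length p = n" if "p \<in> ?P" for p
    using length_finite_permutations_of_set[OF that] by simp
  \<comment> \<open>This is the total contribution of all choices of marked descents whose last
    block has \<open>k\<close> entries.\<close>
  have block: "(\<Sum>p\<in>?P. ?D k p * q ^ c_ba (take (n - k) p)) =
      coeff_a q n k * stat_gf c_ba q (n - k)" if k: "1 \<le> k" "k \<le> n" for k
  proof -
    define g where "g S = (\<Prod>x\<in>S - {Min S}. q ^ (n - x) - 1)" for S
    have "(\<Sum>p\<in>?P. ?D k p * q ^ c_ba (take (n - k) p)) =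
        (\<Sum>p | p \<in> ?P \<and> decr_from (n - k) p. ?D k p * q ^ c_ba (take (n - k) p))"
    proof (intro sum.mono_neutral_right ballI)
      fix p assume "p \<in> ?P - {p \<in> ?P. decr_from (n - k) p}"
      then have "?D k p = 0" by (intro prod_desc_factor_not_decr) (auto simp: len)
      then show "?D k p * q ^ c_ba (take (n - k) p) = 0" by (simp only: mult_zero_left)
    qed auto
    also have "\<dots> = (\<Sum>p | p \<in> ?P \<and> decr_from (n - k) p.
        g (set (drop (n - k) p)) * q ^ c_ba (take (n - k) p))"
    proof (rule sum.cong)
      fix p assume "p \<in> {p \<in> ?P. decr_from (n - k) p}"
      then have "?D k p = g (set (drop (n - k) p))"
        unfolding g_def using k by (intro prod_desc_factor_decr) auto
      then show "?D k p * q ^ c_ba (take (n - k) p) =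
          g (set (drop (n - k) p)) * q ^ c_ba (take (n - k) p)"
        by (simp only:)
    qed simp
    also have "\<dots> = (\<Sum>S\<in>subsets_of_card n k.
        \<Sum>u\<in>permutations_of_set ({1..n} - S). g S * q ^ c_ba u)"
      by (rule sum_decr_from[OF k(2)])
    \<comment> \<open>The inner sum depends on \<open>S\<close> only through the size
      \<open>n - k\<close> of its complement.\<close>
    also have "\<dots> = (\<Sum>S\<in>subsets_of_card n k. g S * stat_gf c_ba q (n - k))"
    proof (rule sum.cong)
      fix S assume S: "S \<in> subsets_of_card n k"
      have "card ({1..n} - S) = n - k"
        using subsets_of_cardD[OF S] by (simp add: card_Diff_subset)
      then show "(\<Sum>u\<in>permutations_of_set ({1..n} - S). g S * q ^ c_ba u) =
          g S * stat_gf c_ba q (n - k)"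
        by (simp add: sum_distrib_left[symmetric] sum_power_c_ba_card)
    qed simp
    also have "\<dots> = coeff_a q n k * stat_gf c_ba q (n - k)"
      using k by (simp add: coeff_a_conv_subsets g_def sum_distrib_right)
    finally show ?thesis .
  qed
  have "stat_gf c_ba q n = (\<Sum>p\<in>?P. \<Sum>k=1..n. ?D k p * q ^ c_ba (take (n - k) p))"
    unfolding stat_gf_def
    by (rule sum.cong[OF refl]) (rule power_c_ba_last_block[OF len assms])
  also have "\<dots> = (\<Sum>k=1..n. \<Sum>p\<in>?P. ?D k p * q ^ c_ba (take (n - k) p))"
    by (rule sum.swap)
  also have "\<dots> = (\<Sum>k=1..n. coeff_a q n k * stat_gf c_ba q (n - k))"
    by (rule sum.cong[OF refl]) (rule block; simp)
  finally show ?thesis .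
qed

subsection \<open>Symmetries\<close>

lemma rev_in_permutations_of_set:
  "p \<in> permutations_of_set A \<Longrightarrow> rev p \<in> permutations_of_set A"
  by (simp add: permutations_of_set_def)

lemma perm_complement_in_permutations_of_set:
  assumes "p \<in> permutations_of_set {1..n}"
  shows "perm_complement p \<in> permutations_of_set {1..n}"
proof -
  let ?f = "\<lambda>x. Suc n - x"
  have len: "length p = n" using length_finite_permutations_of_set[OF assms] by simp
  have inj: "inj_on ?f {1..n}" by (auto simp: inj_on_def)
  have "?f ` {1..n} = {1..n}"
    by (rule bij_betw_imp_surj_on, rule bij_betw_byWitness[where f' = ?f]) auto
  then have "permutations_of_set {1..n} = map ?f ` permutations_of_set {1..n}"
    using permutations_of_set_image_inj[OF inj] by simp
  then show ?thesis using assms len by (auto simp: perm_complement_def)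
qed

lemma perm_complement_perm_complement:
  assumes "p \<in> permutations_of_set {1..n}"
  shows "perm_complement (perm_complement p) = p"
proof -
  have "length p = n" using length_finite_permutations_of_set[OF assms] by simp
  moreover have "set p = {1..n}" using assms by (rule permutations_of_setD)
  ultimately show ?thesis
    by (auto simp: perm_complement_def intro!: map_idI)
qed

text \<open>Reversal is an involution of the summation range, so it merely reorders the sum,
  whatever the statistic is.\<close>

lemma stat_gf_reversal: "stat_gf (stat_reversal \<sigma>) q n = stat_gf \<sigma> q n"
  unfolding stat_gf_def stat_reversal_def
  by (rule sum.reindex_bij_witness[where i = rev and j = rev])
    (auto simp: rev_in_permutations_of_set)

lemma stat_gf_complement: "stat_gf (stat_complement \<sigma>) q n = stat_gf \<sigma> q n"
  unfolding stat_gf_def stat_complement_def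
  by (rule sum.reindex_bij_witness[where i = perm_complement and j = perm_complement])
    (simp_all only: perm_complement_in_permutations_of_set perm_complement_perm_complement)

lemma stat_gf_reverse_complement: "stat_gf (stat_reverse_complement \<sigma>) q n = stat_gf \<sigma> q n"
proof -
  \<comment> \<open>The operations on statistics compose in the opposite order to those on words:
    the complement is applied to the word first.\<close>
  have "stat_reverse_complement \<sigma> = stat_complement (stat_reversal \<sigma>)"
    by (simp add: fun_eq_iff stat_reverse_complement_def stat_complement_def stat_reversal_def)
  then show ?thesis by (simp add: stat_gf_complement stat_gf_reversal)
qed

theorem mainTheorem8:
  fixes q :: "'a::comm_ring_1"
  shows "(\<forall>n\<ge>1. stat_gf c_ba q n = (\<Sum>k=1..n. coeff_a q n k * stat_gf c_ba q (n - k)))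
    \<and> (\<forall>n\<ge>2. \<forall>k\<ge>2. coeff_a q n k = coeff_b q (n - 1) (k - 1))
    \<and> (\<forall>n\<ge>2. \<forall>k\<ge>2. coeff_b q n k =
          coeff_b q (n - 1) k + coeff_c q (n - 1) k + (q ^ (n - 1) - 1) * coeff_c q (n - 1) (k - 1))
    \<and> (\<forall>n\<ge>2. \<forall>k\<ge>2. coeff_c q n k =
          coeff_c q (n - 1) k + (q ^ (n - 1) - 1) * coeff_c q (n - 1) (k - 1))
    \<and> (\<forall>\<sigma>\<in>{stat_reversal c_ba, stat_complement c_ba, stat_reverse_complement c_ba}.
          \<forall>n\<ge>1. stat_gf \<sigma> q n = (\<Sum>k=1..n. coeff_a q n k * stat_gf \<sigma> q (n - k)))"
proof (intro conjI allI ballI impI)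
  fix n k :: nat assume "n \<ge> 2" "k \<ge> 2"
  then obtain m l where nk: "n = Suc m" "k = Suc l" "l \<ge> 1"
    by (cases n; cases k) auto
  show "coeff_a q n k = coeff_b q (n - 1) (k - 1)"
    using coeff_a_eq_coeff_b[OF nk(3)] by (simp add: nk)
  show "coeff_b q n k =
      coeff_b q (n - 1) k + coeff_c q (n - 1) k + (q ^ (n - 1) - 1) * coeff_c q (n - 1) (k - 1)"
    by (simp add: nk coeff_b_rec)
  show "coeff_c q n k = coeff_c q (n - 1) k + (q ^ (n - 1) - 1) * coeff_c q (n - 1) (k - 1)"
    by (simp add: nk coeff_c_rec)
next
  fix \<sigma> and n :: nat
  assume "\<sigma> \<in> {stat_reversal c_ba, stat_complement c_ba, stat_reverse_complement c_ba}"
    and n: "n \<ge> 1"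
  \<comment> \<open>Equality is needed at every \<open>m\<close>, since the recurrence also
    evaluates the generating function at each \<open>n - k\<close>.\<close>
  then have "stat_gf \<sigma> q m = stat_gf c_ba q m" for m
    by (auto simp: stat_gf_reversal stat_gf_complement stat_gf_reverse_complement)
  then show "stat_gf \<sigma> q n = (\<Sum>k=1..n. coeff_a q n k * stat_gf \<sigma> q (n - k))"
    by (simp only: stat_gf_c_ba_rec[OF n])
qed (rule stat_gf_c_ba_rec)

end
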